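(* Fix a probability mass function $V$ whose support is the whole of $\mathbb{Z}_+=\{0,1,2,\dots\}$, and a constant $c$. Then the Poincaré inequality $$\mathrm{Var}_V(f)\le\frac1c\sum_{x=0}^\infty V(x)\,\bigl(f(x+1)-f(x)\bigr)^2$$ holds for any function $f$ if and only if $V$ satisfies the integrated BE($c$) condition.
   Context: Functions are real-valued functions on $\mathbb{Z}_+$. Convention: $V(-1)=0$ (so terms multiplied by $V(-1)$ are $0$). For a function $f$, $\mathrm{Var}_V(f)=\sum_{x=0}^\infty V(x)(f(x)-\mu_{V,f})^2$, where $\mu_{V,f}=\sum_{x=0}^\infty V(x)f(x)$. Define the birth-and-death generator $$L_Vf(x)=\bigl(f(x+1)-f(x)\bigr)-\frac{V(x-1)}{V(x)}\bigl(f(x)-f(x-1)\bigr),$$ and the operators $$\Gamma^{(V)}_1(f,g)=\tfrac12\left[L_V(fg)-fL_Vg-gL_Vf\right],$$ $$\Gamma^{(V)}_2(f,g)=\tfrac12\left[L_V\bigl(\Gamma^{(V)}_1(f,g)\bigr)-\Gamma^{(V)}_1(f,L_Vg)-\Gamma^{(V)}_1(g,L_Vf)\right].$$ $V$ satisfies the integrated BE($c$) condition if for all functions $f$ $$\sum_{x=0}^\infty V(x)\,\Gamma^{(V)}_2(f,f)(x)\ \ge\ c\sum_{x=0}^\infty V(x)\,\Gamma^{(V)}_1(f,f)(x).$$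
   Formalization: The constant c is taken positive: 1/c is undefined at c = 0, and for c < 0 the equivalence is false, since the Poincaré inequality fails for every nonconstant f with a finite right-hand sum while the integrated BE(c) condition holds. *)

theory Defs
  imports "HOL-Probability.Probability"
begin

text \<open>
  The mean of \<open>f\<close> is a real series, meaningful when that series converges.  The variance is a
  series of nonnegative terms and is taken in \<open>[0, \<infinity>]\<close>, so that it is defined
  for every \<open>f\<close> that has a mean.
\<close>

definition mean :: "nat pmf \<Rightarrow> (nat \<Rightarrow> real) \<Rightarrow> real" where
  "mean V f = (\<Sum>x. pmf V x * f x)"

definition Var :: "nat pmf \<Rightarrow> (nat \<Rightarrow> real) \<Rightarrow> ennreal" where
  "Var V f = (\<Sum>x. ennreal (pmf V x * (f x - mean V f)\<^sup>2))"

text \<open>The convention \<open>V(-1) = 0\<close> makes the backward term of the generator vanish at \<open>x = 0\<close>.\<close>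

definition death_rate :: "nat pmf \<Rightarrow> nat \<Rightarrow> real" where
  "death_rate V x = (if x = 0 then 0 else pmf V (x - 1) / pmf V x)"

definition L :: "nat pmf \<Rightarrow> (nat \<Rightarrow> real) \<Rightarrow> nat \<Rightarrow> real" where
  "L V f x = (f (x + 1) - f x) - death_rate V x * (f x - f (x - 1))"

definition Gamma1 :: "nat pmf \<Rightarrow> (nat \<Rightarrow> real) \<Rightarrow> (nat \<Rightarrow> real) \<Rightarrow> nat \<Rightarrow> real" where
  "Gamma1 V f g x = 1/2 * (L V (\<lambda>y. f y * g y) x - f x * L V g x - g x * L V f x)"

definition Gamma2 :: "nat pmf \<Rightarrow> (nat \<Rightarrow> real) \<Rightarrow> (nat \<Rightarrow> real) \<Rightarrow> nat \<Rightarrow> real" where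
  "Gamma2 V f g x =
     1/2 * (L V (Gamma1 V f g) x - Gamma1 V f (L V g) x - Gamma1 V g (L V f) x)"

text \<open>
  The terms \<open>V(x) \<Gamma>\<^sub>2(f,f)(x)\<close> may have either sign, so the condition ranges over all \<open>f\<close> for
  which the two series converge to real numbers.
\<close>

definition integrated_BE :: "nat pmf \<Rightarrow> real \<Rightarrow> bool" where
  "integrated_BE V c \<longleftrightarrow>
     (\<forall>f. summable (\<lambda>x. pmf V x * Gamma1 V f f x) \<longrightarrow>
          summable (\<lambda>x. pmf V x * Gamma2 V f f x) \<longrightarrow>
          (\<Sum>x. pmf V x * Gamma2 V f f x) \<ge> c * (\<Sum>x. pmf V x * Gamma1 V f f x))"

end

theory Submission
  imports Defs
begin

text \<open>
  Write \<open>\<Delta>f(x) = f(x+1) - f(x)\<close>.  The generator is reversible with respect to \<open>V\<close>, its Dirichlet form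
  is \<open>\<Sum> V \<Gamma>\<^sub>1(f,f) = \<Sum> V (\<Delta>f)\<^sup>2\<close>, and formally, since sums of \<open>V L(\<dots>)\<close> telescope to zero and \<open>L\<close> is
  symmetric, \<open>\<Sum> V \<Gamma>\<^sub>2(f,f) = \<Sum> V (L f)\<^sup>2\<close>.  So the integrated condition says
  \<open>\<Sum> V (L f)\<^sup>2 \<ge> c \<Sum> V (\<Delta>f)\<^sup>2\<close>, which, like the Poincare inequality, is a way of saying that \<open>-L\<close> has
  a spectral gap of at least \<open>c\<close>.

  What needs care is the boundary at infinity, as \<open>f\<close> need not be square integrable and the death
  rates \<open>V(x-1) / V(x)\<close> may be unbounded.  Both conditions are therefore compared with a finitary
  one, \<open>spectral_gap\<close>: the displayed inequality for eventually constant \<open>f\<close>, where every sum is finite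
  and the formal computations are exact.

  \<^item> From the integrated condition to the finitary one there is nothing but the finite computation.

  \<^item> From Poincare to the finitary inequality: expand
    \<open>0 \<le> \<Sum> V (L f + c (f - \<mu>))\<^sup>2\<close> and use \<open>\<Sum> V (L f) (f - \<mu>) = - \<Sum> V (\<Delta>f)\<^sup>2\<close>.

  \<^item> From the finitary inequality to Poincare: by duality.  If \<open>g\<close> is \<open>f\<close> minus its mean over
    \<open>{0..N}\<close>, the equation \<open>L u = g\<close> on \<open>{0..N}\<close> has a solution \<open>u\<close> that is constant from \<open>N\<close> on;
    testing \<open>g\<close> against \<open>L u\<close> bounds \<open>\<Sum>\<^bsub>x\<le>N\<^esub> V g\<^sup>2\<close>, and then \<open>N\<close> tends to infinity.

  \<^item> From the finitary inequality to the integrated condition: let \<open>f\<^sub>n(x) = f(min(x,n))\<close>.  The boundary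
    terms in the \<open>n\<close>-th partial sum of \<open>V \<Gamma>\<^sub>2(f,f)\<close> form a quadratic form in the increments of \<open>f\<close>
    next to \<open>n\<close>.  It is not small, but completing squares shows that for every \<open>z < 1\<close> the partial sum
    is at least \<open>z \<Sum> V (L f\<^sub>n)\<^sup>2\<close> up to a multiple of \<open>V(n) \<Gamma>\<^sub>1(f,f)(n)\<close>, a null sequence.  One applies
    the finitary inequality to \<open>f\<^sub>n\<close>, lets \<open>n\<close> tend to infinity, and then \<open>z\<close> to 1.
\<close>

section \<open>The finitary spectral gap\<close>

lemma sums_pmf_nat: "pmf V sums 1" for V :: "nat pmf"
proof -
  have "(\<lambda>x. ennreal (pmf V x)) sums (\<integral>\<^sup>+ x. ennreal (pmf V x) \<partial>count_space UNIV)"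
    by (simp add: nn_integral_count_space_nat summable_sums)
  then have "(\<lambda>x. ennreal (pmf V x)) sums ennreal 1"
    by (simp add: nn_integral_pmf measure_pmf.emeasure_eq_1_AE)
  then show ?thesis
    by (subst (asm) sums_ennreal) auto
qed

text \<open>
  For a function that is constant from \<open>N\<close> on, \<open>\<Delta>f\<close> vanishes from \<open>N\<close> on and \<open>L f\<close> vanishes beyond \<open>N\<close>,
  so the two sums are the full sums over the nonnegative integers.
\<close>

definition spectral_gap :: "nat pmf \<Rightarrow> real \<Rightarrow> bool" where
  "spectral_gap V c \<longleftrightarrow>
     (\<forall>f N. (\<forall>x\<ge>N. f x = f N) \<longrightarrow>
        c * (\<Sum>x<N. pmf V x * (f (Suc x) - f x)\<^sup>2) \<le> (\<Sum>x\<le>N. pmf V x * (L V f x)\<^sup>2))"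

lemma summable_eventually_constant:
  fixes V :: "nat pmf"
  assumes const: "\<And>x. x \<ge> N \<Longrightarrow> f x = f N"
  shows "summable (\<lambda>x. pmf V x * f x)"
proof -
  have "summable (\<lambda>x. pmf V x * (f x - f N))"
    by (rule summable_finite[of "{..<N}"]) (auto simp: not_less dest: const)
  moreover have "summable (\<lambda>x. pmf V x * f N)"
    using sums_pmf_nat[of V] by (intro summable_mult2) (auto simp: sums_iff)
  ultimately have "summable (\<lambda>x. pmf V x * (f x - f N) + pmf V x * f N)"
    by (rule summable_add)
  then show ?thesis
    by (simp add: algebra_simps)
qed

section \<open>Summation by parts for the birth-and-death generator\<close>

context
  fixes V :: "nat pmf"
  assumes pos: "\<And>x. pmf V x > 0"
begin

lemma pmf_death_rate: "pmf V x * death_rate V x = (if x = 0 then 0 else pmf V (x - 1))"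
  using pos[of x] by (simp add: death_rate_def)

text \<open>
  Detailed balance: \<open>V(x) L f(x)\<close> is the difference of the fluxes \<open>V \<Delta>f\<close> through the edges on the two
  sides of \<open>x\<close>.  Sums of \<open>V L f\<close> telescope for this reason.
\<close>

lemma pmf_L:
  "pmf V x * L V f x =
     pmf V x * (f (Suc x) - f x) - (if x = 0 then 0 else pmf V (x - 1) * (f x - f (x - 1)))"
proof -
  have "pmf V x * L V f x =
      pmf V x * (f (Suc x) - f x) - pmf V x * death_rate V x * (f x - f (x - 1))"
    by (simp add: L_def algebra_simps)
  then show ?thesis
    by (simp add: pmf_death_rate)
qed

lemma sum_pmf_L: "(\<Sum>x\<le>n. pmf V x * L V f x) = pmf V n * (f (Suc n) - f n)"
  by (induction n) (simp_all add: pmf_L)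

lemma summation_by_parts:
  "(\<Sum>x\<le>n. pmf V x * L V f x * g x) =
     pmf V n * (f (Suc n) - f n) * g n - (\<Sum>x<n. pmf V x * (f (Suc x) - f x) * (g (Suc x) - g x))"
  by (induction n) (simp_all add: pmf_L algebra_simps)

lemma Gamma1_eq:
  "Gamma1 V f g x =
     1/2 * ((f (Suc x) - f x) * (g (Suc x) - g x)
            + death_rate V x * ((f x - f (x - 1)) * (g x - g (x - 1))))"
  by (simp add: Gamma1_def L_def algebra_simps)

text \<open>
  Each edge contributes equally to its two endpoints, so only the edge from \<open>n\<close> to \<open>n+1\<close> is counted
  by half.
\<close>

lemma sum_pmf_Gamma1:
  "(\<Sum>x\<le>n. pmf V x * Gamma1 V f g x) =
     (\<Sum>x<n. pmf V x * (f (Suc x) - f x) * (g (Suc x) - g x))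
     + 1/2 * pmf V n * (f (Suc n) - f n) * (g (Suc n) - g n)"
proof (induction n)
  case 0
  then show ?case
    by (simp add: Gamma1_eq death_rate_def)
next
  case (Suc n)
  have "pmf V (Suc n) * Gamma1 V f g (Suc n) =
      1/2 * (pmf V (Suc n) * ((f (Suc (Suc n)) - f (Suc n)) * (g (Suc (Suc n)) - g (Suc n)))
       + (pmf V (Suc n) * death_rate V (Suc n)) * ((f (Suc n) - f n) * (g (Suc n) - g n)))"
    by (simp add: Gamma1_eq algebra_simps)
  then show ?case
    using Suc.IH by (simp add: pmf_death_rate)
qed

text \<open>
  The first half of \<open>\<Gamma>\<^sub>2\<close> telescopes and the second becomes \<open>(L f)\<^sup>2\<close> after summation by parts.
\<close>

lemma sum_pmf_Gamma2:
  "(\<Sum>x\<le>n. pmf V x * Gamma2 V f f x) =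
     (\<Sum>x\<le>n. pmf V x * (L V f x)\<^sup>2)
     + 1/2 * pmf V n * (Gamma1 V f f (Suc n) - Gamma1 V f f n)
     - 1/2 * pmf V n * (f (Suc n) - f n) * (L V f n + L V f (Suc n))"
proof -
  have "(\<Sum>x\<le>n. pmf V x * Gamma2 V f f x) =
      (\<Sum>x\<le>n. 1/2 * (pmf V x * L V (Gamma1 V f f) x) - pmf V x * Gamma1 V f (L V f) x)"
    by (intro sum.cong) (simp_all add: Gamma2_def algebra_simps)
  also have "\<dots> = 1/2 * (\<Sum>x\<le>n. pmf V x * L V (Gamma1 V f f) x)
      - (\<Sum>x\<le>n. pmf V x * Gamma1 V f (L V f) x)"
    by (simp add: sum_subtractf sum_distrib_left)
  also have "\<dots> = 1/2 * (pmf V n * (Gamma1 V f f (Suc n) - Gamma1 V f f n))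
      - (pmf V n * (f (Suc n) - f n) * L V f n - (\<Sum>x\<le>n. pmf V x * L V f x * L V f x)
         + 1/2 * pmf V n * (f (Suc n) - f n) * (L V f (Suc n) - L V f n))"
    unfolding sum_pmf_L sum_pmf_Gamma1 using summation_by_parts[of f "L V f" n] by simp
  finally show ?thesis
    by (simp add: power2_eq_square field_simps)
qed

section \<open>From the integrated condition to the spectral gap\<close>

lemma integrated_BE_imp_spectral_gap:
  assumes BE: "integrated_BE V c"
  shows "spectral_gap V c"
  unfolding spectral_gap_def
proof (intro allI impI)
  fix f :: "nat \<Rightarrow> real" and N
  assume "\<forall>x\<ge>N. f x = f N"
  then have const: "f x = f N" if "x \<ge> N" for x
    using that by blast
  have step: "f (Suc x) = f x" if "x \<ge> N" for x
    using that const[of x] const[of "Suc x"] by simp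
  have L0: "L V f x = 0" if "x > N" for x
    using that const[of x] const[of "x + 1"] const[of "x - 1"] by (simp add: L_def)
  have G0: "Gamma1 V f g x = 0" if "x > N" for g x
    using that const[of x] const[of "Suc x"] const[of "x - 1"] by (simp add: Gamma1_eq)
  have 1: "(\<lambda>x. pmf V x * Gamma1 V f f x) sums (\<Sum>x<N. pmf V x * (f (Suc x) - f x)\<^sup>2)"
  proof -
    have "(\<lambda>x. pmf V x * Gamma1 V f f x) sums (\<Sum>x\<le>N. pmf V x * Gamma1 V f f x)"
      by (rule sums_finite) (auto simp: G0)
    then show ?thesis
      by (simp add: sum_pmf_Gamma1 step power2_eq_square mult.assoc)
  qed
  have 2: "(\<lambda>x. pmf V x * Gamma2 V f f x) sums (\<Sum>x\<le>N. pmf V x * (L V f x)\<^sup>2)"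
  proof -
    have "L V (Gamma1 V f f) x = 0" if "x > Suc N" for x
      using that by (simp add: L_def G0)
    then have "(\<lambda>x. pmf V x * Gamma2 V f f x) sums (\<Sum>x\<le>Suc N. pmf V x * Gamma2 V f f x)"
      by (intro sums_finite) (auto simp: Gamma2_def G0)
    also have "(\<Sum>x\<le>Suc N. pmf V x * Gamma2 V f f x) = (\<Sum>x\<le>Suc N. pmf V x * (L V f x)\<^sup>2)"
      unfolding sum_pmf_Gamma2 by (simp add: G0 step)
    also have "\<dots> = (\<Sum>x\<le>N. pmf V x * (L V f x)\<^sup>2)"
      by (simp add: L0)
    finally show ?thesis .
  qed
  show "c * (\<Sum>x<N. pmf V x * (f (Suc x) - f x)\<^sup>2) \<le> (\<Sum>x\<le>N. pmf V x * (L V f x)\<^sup>2)"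
    using BE 1 2 by (auto simp: integrated_BE_def sums_iff)
qed

section \<open>The spectral gap and the Poincare inequality\<close>

text \<open>
  This is the Poincare inequality for \<open>V\<close> restricted to \<open>{0..N}\<close>.  Centredness makes the Poisson
  equation \<open>L u = g\<close> solvable on \<open>{0..N}\<close> without flux out of \<open>N\<close>; the finitary inequality bounds
  \<open>\<Sum> V (\<Delta>u)\<^sup>2\<close> by \<open>\<Sum> V g\<^sup>2\<close>, while \<open>\<Sum> V g\<^sup>2 = \<Sum> V (L u) g = - \<Sum> V \<Delta>u \<Delta>g\<close>.
\<close>

lemma spectral_gap_imp_centred_sum_le:
  assumes gap: "spectral_gap V c" and c: "c > 0"
    and centred: "(\<Sum>x\<le>N. pmf V x * g x) = 0"
  shows "c * (\<Sum>x\<le>N. pmf V x * (g x)\<^sup>2) \<le> (\<Sum>x<N. pmf V x * (g (Suc x) - g x)\<^sup>2)"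
proof -
  \<comment> \<open>Summing \<open>V L u = V g\<close> up to \<open>n\<close> forces the flux \<open>V(n) \<Delta>u(n)\<close> to be \<open>w n\<close>.\<close>
  define w where "w n = (\<Sum>x\<le>n. pmf V x * g x)" for n
  define u where "u x = (\<Sum>y<min x N. w y / pmf V y)" for x
  have du: "u (Suc x) - u x = (if x < N then w x / pmf V x else 0)" for x
    by (simp add: u_def min_def not_less_eq_eq)
  have wN: "w N = 0"
    using centred by (simp add: w_def)
  have Lu: "L V u x = g x" if "x \<le> N" for x
  proof -
    have flux: "pmf V y * (u (Suc y) - u y) = w y" if "y \<le> N" for y
      using that wN pos[of y] by (cases "y = N") (auto simp: du)
    have "pmf V x * L V u x = pmf V x * g x"
    proof (cases x)
      case 0
      then show ?thesis
        by (simp add: pmf_L flux) (simp add: w_def)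
    next
      case (Suc y)
      then have "pmf V x * L V u x = w (Suc y) - w y"
        using that by (simp add: pmf_L flux)
      then show ?thesis
        by (simp add: w_def Suc)
    qed
    then show ?thesis
      using pos[of x] by simp
  qed
  define T where "T = (\<Sum>x\<le>N. pmf V x * (g x)\<^sup>2)"
  define D where "D = (\<Sum>x<N. pmf V x * (u (Suc x) - u x)\<^sup>2)"
  define E where "E = (\<Sum>x<N. pmf V x * (g (Suc x) - g x)\<^sup>2)"
  have "c * D \<le> (\<Sum>x\<le>N. pmf V x * (L V u x)\<^sup>2)"
    unfolding D_def
    by (intro gap[unfolded spectral_gap_def, rule_format]) (simp add: u_def)
  also have "\<dots> = T"
    unfolding T_def by (intro sum.cong) (simp_all add: Lu)
  finally have "c * D \<le> T" .
  have "T = (\<Sum>x\<le>N. pmf V x * L V u x * g x)"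
    unfolding T_def by (intro sum.cong) (simp_all add: Lu power2_eq_square)
  also have "\<dots> = - (\<Sum>x<N. pmf V x * (u (Suc x) - u x) * (g (Suc x) - g x))"
    unfolding summation_by_parts by (simp add: du)
  finally have T: "T = - (\<Sum>x<N. pmf V x * (u (Suc x) - u x) * (g (Suc x) - g x))" .
  \<comment> \<open>The Cauchy--Schwarz inequality for \<open>\<Delta>u\<close> and \<open>\<Delta>g\<close>, weighted so that \<open>c * D \<le> T\<close> applies.\<close>
  have "0 \<le> (\<Sum>x<N. pmf V x * (c * (u (Suc x) - u x) + (g (Suc x) - g x))\<^sup>2)"
    by (intro sum_nonneg) simp
  also have "\<dots> = c\<^sup>2 * D
      + 2 * c * (\<Sum>x<N. pmf V x * (u (Suc x) - u x) * (g (Suc x) - g x)) + E"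
    unfolding D_def E_def
    by (simp add: sum_distrib_left sum.distrib[symmetric])
       (intro sum.cong refl, simp add: power2_eq_square algebra_simps)
  also have "\<dots> \<le> E - c * T"
    using mult_left_mono[OF \<open>c * D \<le> T\<close>, of c] c by (simp add: T power2_eq_square)
  finally show ?thesis
    by (simp add: T_def E_def)
qed

lemma tendsto_conditional_mean:
  assumes sm: "summable (\<lambda>x. pmf V x * f x)"
  shows "(\<lambda>N. (\<Sum>x\<le>N. pmf V x * f x) / (\<Sum>x\<le>N. pmf V x)) \<longlonglongrightarrow> mean V f"
proof -
  have "(\<lambda>N. \<Sum>x\<le>N. pmf V x * f x) \<longlonglongrightarrow> mean V f"
    unfolding mean_def by (rule summable_LIMSEQ'[OF sm])
  moreover have "(\<lambda>N. \<Sum>x\<le>N. pmf V x) \<longlonglongrightarrow> 1"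
    using sums_pmf_nat[of V] by (simp add: sums_def_le)
  ultimately have "(\<lambda>N. (\<Sum>x\<le>N. pmf V x * f x) / (\<Sum>x\<le>N. pmf V x)) \<longlonglongrightarrow> mean V f / 1"
    by (rule tendsto_divide) simp
  then show ?thesis
    by simp
qed

text \<open>
  The inequality on \<open>{0..N}\<close> is centred at the conditional mean \<open>m N\<close>.  Keeping only the terms up to a
  fixed \<open>M\<close> allows the limit in \<open>N\<close> to be taken in a finite sum; if the right-hand
  side is finite, square integrability of \<open>f\<close> results.
\<close>

lemma spectral_gap_imp_Poincare:
  assumes gap: "spectral_gap V c" and c: "c > 0"
    and sm: "summable (\<lambda>x. pmf V x * f x)"
  shows "Var V f \<le> ennreal (1 / c) * (\<Sum>x. ennreal (pmf V x * (f (x + 1) - f x)\<^sup>2))"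
proof (cases "(\<Sum>x. ennreal (pmf V x * (f (x + 1) - f x)\<^sup>2)) = top")
  case True
  then show ?thesis
    using c by (simp add: ennreal_mult_top)
next
  case False
  define E where "E = (\<Sum>x. pmf V x * (f (x + 1) - f x)\<^sup>2)"
  have smE: "summable (\<lambda>x. pmf V x * (f (x + 1) - f x)\<^sup>2)"
    using False by (intro summable_suminf_not_top) simp_all
  have E: "(\<Sum>x. ennreal (pmf V x * (f (x + 1) - f x)\<^sup>2)) = ennreal E"
    unfolding E_def using False by (intro suminf_ennreal) simp_all
  define m where "m N = (\<Sum>x\<le>N. pmf V x * f x) / (\<Sum>x\<le>N. pmf V x)" for N
  have m_lim: "m \<longlonglongrightarrow> mean V f"
    using tendsto_conditional_mean[OF sm] by (simp add: m_def[abs_def])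
  have le_m: "(\<Sum>x\<le>M. pmf V x * (f x - m N)\<^sup>2) \<le> E / c" if "M \<le> N" for M N
  proof -
    have "(\<Sum>x\<le>N. pmf V x) > 0"
      by (intro sum_pos) (auto simp: pos)
    then have "(\<Sum>x\<le>N. pmf V x * (f x - m N)) = 0"
      unfolding right_diff_distrib sum_subtractf sum_distrib_right[symmetric] m_def by simp
    then have "c * (\<Sum>x\<le>N. pmf V x * (f x - m N)\<^sup>2) \<le> (\<Sum>x<N. pmf V x * (f (Suc x) - f x)\<^sup>2)"
      using spectral_gap_imp_centred_sum_le[OF gap c, where N = N and g = "\<lambda>x. f x - m N"] by simp
    also have "\<dots> \<le> E"
      unfolding E_def using smE by (simp add: sum_le_suminf)
    finally have "(\<Sum>x\<le>N. pmf V x * (f x - m N)\<^sup>2) \<le> E / c"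
      using c by (simp add: field_simps)
    moreover have "(\<Sum>x\<le>M. pmf V x * (f x - m N)\<^sup>2) \<le> (\<Sum>x\<le>N. pmf V x * (f x - m N)\<^sup>2)"
      using that by (intro sum_mono2) auto
    ultimately show ?thesis
      by linarith
  qed
  have le: "(\<Sum>x\<le>M. pmf V x * (f x - mean V f)\<^sup>2) \<le> E / c" for M
  proof (rule LIMSEQ_le_const2)
    show "(\<lambda>N. \<Sum>x\<le>M. pmf V x * (f x - m N)\<^sup>2) \<longlonglongrightarrow> (\<Sum>x\<le>M. pmf V x * (f x - mean V f)\<^sup>2)"
      by (intro tendsto_intros m_lim)
    show "\<exists>K. \<forall>N\<ge>K. (\<Sum>x\<le>M. pmf V x * (f x - m N)\<^sup>2) \<le> E / c"
      using le_m by blast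
  qed
  have "Var V f \<le> ennreal (E / c)"
    unfolding Var_def
  proof (rule suminf_le_const)
    fix n
    have "(\<Sum>x<n. pmf V x * (f x - mean V f)\<^sup>2) \<le> (\<Sum>x\<le>n. pmf V x * (f x - mean V f)\<^sup>2)"
      by (intro sum_mono2) auto
    also have "\<dots> \<le> E / c"
      by (rule le)
    finally show "(\<Sum>x<n. ennreal (pmf V x * (f x - mean V f)\<^sup>2)) \<le> ennreal (E / c)"
      by (simp add: ennreal_leI)
  qed simp
  also have "ennreal (E / c) = ennreal (1 / c) * ennreal E"
    using c by (simp add: ennreal_mult'[symmetric])
  finally show ?thesis
    by (simp only: E)
qed

text \<open>
  The square \<open>(L f + c (f - \<mu>))\<^sup>2\<close> is summed over \<open>{0..N}\<close> only, as \<open>L f\<close> vanishes elsewhere; the part of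
  the variance beyond \<open>N\<close> is discarded.
\<close>

lemma Poincare_imp_spectral_gap:
  assumes c: "c > 0"
    and Poincare: "\<And>f. summable (\<lambda>x. pmf V x * f x) \<Longrightarrow>
      Var V f \<le> ennreal (1 / c) * (\<Sum>x. ennreal (pmf V x * (f (x + 1) - f x)\<^sup>2))"
  shows "spectral_gap V c"
  unfolding spectral_gap_def
proof (intro allI impI)
  fix f :: "nat \<Rightarrow> real" and N
  assume "\<forall>x\<ge>N. f x = f N"
  then have const: "f x = f N" if "x \<ge> N" for x
    using that by blast
  have step: "f (Suc x) = f x" if "x \<ge> N" for x
    using that const[of x] const[of "Suc x"] by simp
  define m where "m = mean V f"
  define E where "E = (\<Sum>x<N. pmf V x * (f (Suc x) - f x)\<^sup>2)"
  define W where "W = (\<Sum>x\<le>N. pmf V x * (f x - m)\<^sup>2)"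
  define H where "H = (\<Sum>x\<le>N. pmf V x * (L V f x)\<^sup>2)"
  have E0: "E \<ge> 0"
    unfolding E_def by (intro sum_nonneg) simp
  have "ennreal W = (\<Sum>x\<le>N. ennreal (pmf V x * (f x - m)\<^sup>2))"
    by (simp add: W_def)
  also have "\<dots> \<le> Var V f"
    unfolding Var_def m_def by (intro sum_le_suminf) simp_all
  also have "\<dots> \<le> ennreal (1 / c) * (\<Sum>x. ennreal (pmf V x * (f (x + 1) - f x)\<^sup>2))"
    by (rule Poincare) (rule summable_eventually_constant[of N], rule const)
  also have "(\<Sum>x. ennreal (pmf V x * (f (x + 1) - f x)\<^sup>2)) = ennreal E"
    unfolding E_def
    by (subst suminf_finite[of "{..<N}"]) (auto simp: step)
  also have "ennreal (1 / c) * ennreal E = ennreal (E / c)"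
    using c by (simp add: ennreal_mult'[symmetric])
  finally have "W \<le> E / c"
    using E0 c by simp
  then have W: "c * W \<le> E"
    using c by (simp add: field_simps)
  have cross: "(\<Sum>x\<le>N. pmf V x * L V f x * (f x - m)) = - E"
    unfolding summation_by_parts E_def by (simp add: step power2_eq_square mult.assoc)
  have "0 \<le> (\<Sum>x\<le>N. pmf V x * (L V f x + c * (f x - m))\<^sup>2)"
    by (intro sum_nonneg) simp
  also have "\<dots> = H + 2 * c * (\<Sum>x\<le>N. pmf V x * L V f x * (f x - m)) + c\<^sup>2 * W"
    unfolding H_def W_def
    by (simp add: sum_distrib_left sum.distrib[symmetric])
       (intro sum.cong refl, simp add: power2_eq_square algebra_simps)
  also have "\<dots> \<le> H - c * E"
    using mult_left_mono[OF W, of c] c by (simp add: cross power2_eq_square)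
  finally show "c * E \<le> H"
    by simp
qed

section \<open>Boundary terms of partial sums\<close>

text \<open>
  Stopping \<open>f\<close> at \<open>n\<close> changes \<open>L f\<close> on \<open>{0..n}\<close> at \<open>n\<close> only, where the birth term is lost.
\<close>

lemma sum_pmf_L_stopped:
  "(\<Sum>x\<le>n. pmf V x * (L V (\<lambda>y. f (min y n)) x)\<^sup>2) =
     (\<Sum>x<n. pmf V x * (L V f x)\<^sup>2) + pmf V n * (death_rate V n * (f n - f (n - 1)))\<^sup>2"
proof -
  have "(\<Sum>x<n. pmf V x * (L V (\<lambda>y. f (min y n)) x)\<^sup>2) = (\<Sum>x<n. pmf V x * (L V f x)\<^sup>2)"
    by (intro sum.cong) (auto simp: L_def min_def)
  moreover have "L V (\<lambda>y. f (min y n)) n = - (death_rate V n * (f n - f (n - 1)))"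
    by (simp add: L_def)
  ultimately show ?thesis
    by (simp add: lessThan_Suc_atMost[symmetric])
qed

text \<open>
  Times \<open>V(n)\<close>, the quadratic form in \<open>P\<close>, \<open>Q\<close>, \<open>R\<close> is what the partial sum of \<open>V \<Gamma>\<^sub>2(f,f)\<close> up
  to \<open>n\<close> exceeds \<open>\<Sum>\<^bsub>x<n\<^esub> V (L f)\<^sup>2\<close> by.  Here \<open>P\<close> and \<open>R\<close> are the increments of \<open>f\<close> at \<open>n\<close> and \<open>n+1\<close>, \<open>Q\<close> is
  the death term of \<open>L f\<close> at \<open>n\<close>, \<open>D\<close> is the death rate at \<open>n+1\<close>, and \<open>(P\<^sup>2 + J) / 2\<close> is \<open>\<Gamma>\<^sub>1(f,f)(n)\<close>.
  The form equals \<open>Q\<^sup>2 - 3/2 P Q + (P - R)\<^sup>2 / 4 + 3/4 D P\<^sup>2 - J / 4\<close>.  The products involving the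
  uncontrolled \<open>R\<close> and \<open>D\<close> are absorbed in squares, and the mixed term \<open>P Q\<close> is paid for by
  \<open>(1 - z) Q\<^sup>2\<close> and a multiple of \<open>P\<^sup>2\<close>.
\<close>

lemma boundary_quadratic_form_ge:
  fixes P Q R D J z :: real
  assumes z: "z < 1" and "z > 0" and D: "D \<ge> 0" and J: "J \<ge> 0"
  shows "(P - Q)\<^sup>2 + 1/2 * (1/2 * (R\<^sup>2 + D * P\<^sup>2) - 1/2 * (P\<^sup>2 + J))
           - 1/2 * P * ((P - Q) + (R - D * P))
         \<ge> z * Q\<^sup>2 - 9 / (8 * (1 - z)) * (1/2 * (P\<^sup>2 + J))"
proof -
  define e where "e = 1 - z"
  have e: "e > 0" "e < 1" "z = 1 - e"
    using assms by (auto simp: e_def)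
  \<comment> \<open>This square has the mixed term \<open>- 3/2 P Q\<close> and spends \<open>e = 1 - z\<close> times \<open>Q\<^sup>2\<close> on it.\<close>
  have "0 \<le> (e * Q - 3/4 * P)\<^sup>2 / e"
    using e by simp
  also have "\<dots> = e * Q\<^sup>2 - 3/2 * P * Q + 9 / (16 * e) * P\<^sup>2"
    using e by (simp add: power2_eq_square field_simps)
  finally have 1: "z * Q\<^sup>2 - 9 / (16 * e) * P\<^sup>2 \<le> Q\<^sup>2 - 3/2 * P * Q"
    by (simp add: e(3) algebra_simps)
  have "1/4 \<le> 9 / (16 * e)"
    using e by (simp add: field_simps)
  then have 2: "1/4 * J \<le> 9 / (16 * e) * J"
    using J by (rule mult_right_mono)
  have 3: "0 \<le> 1/4 * (P - R)\<^sup>2 + 3/4 * (D * P\<^sup>2)"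
    using D by simp
  have "(P - Q)\<^sup>2 + 1/2 * (1/2 * (R\<^sup>2 + D * P\<^sup>2) - 1/2 * (P\<^sup>2 + J))
           - 1/2 * P * ((P - Q) + (R - D * P))
      = (Q\<^sup>2 - 3/2 * P * Q) + (1/4 * (P - R)\<^sup>2 + 3/4 * (D * P\<^sup>2)) - 1/4 * J"
    by (simp add: power2_eq_square field_simps)
  moreover have "9 / (8 * (1 - z)) * (1/2 * (P\<^sup>2 + J)) = 9 / (16 * e) * P\<^sup>2 + 9 / (16 * e) * J"
    unfolding e_def[symmetric] using e(1) by (simp add: field_simps)
  ultimately show ?thesis
    using 1 2 3 by linarith
qed

text \<open>
  The term \<open>V(n) Q\<^sup>2\<close> of the quadratic form above that survives at the boundary is exactly the contribution of \<open>n\<close> to the sum for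
  the stopped function.  This is why that function, to which the spectral gap applies, appears here.
\<close>

lemma sum_pmf_Gamma2_ge:
  assumes z: "z < 1" "z > 0"
  shows "(\<Sum>x\<le>n. pmf V x * Gamma2 V f f x) \<ge>
           z * (\<Sum>x\<le>n. pmf V x * (L V (\<lambda>y. f (min y n)) x)\<^sup>2)
           - 9 / (8 * (1 - z)) * (pmf V n * Gamma1 V f f n)"
proof -
  define K where "K = 9 / (8 * (1 - z))"
  define P Q R D J where
    "P = f (Suc n) - f n" and "Q = death_rate V n * (f n - f (n - 1))" and
    "R = f (Suc (Suc n)) - f (Suc n)" and "D = death_rate V (Suc n)" and
    "J = death_rate V n * (f n - f (n - 1))\<^sup>2"
  have DJ: "D \<ge> 0" "J \<ge> 0"
    by (simp_all add: D_def J_def death_rate_def)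
  have eqs: "L V f n = P - Q" "L V f (Suc n) = R - D * P"
    "Gamma1 V f f n = 1/2 * (P\<^sup>2 + J)" "Gamma1 V f f (Suc n) = 1/2 * (R\<^sup>2 + D * P\<^sup>2)"
    by (simp_all add: L_def Gamma1_eq P_def Q_def R_def D_def J_def power2_eq_square)
  define A where "A = (\<Sum>x<n. pmf V x * (L V f x)\<^sup>2)"
  have A0: "A \<ge> 0"
    unfolding A_def by (intro sum_nonneg) simp
  have "(\<Sum>x\<le>n. pmf V x * Gamma2 V f f x) =
      A + pmf V n * ((P - Q)\<^sup>2 + 1/2 * (1/2 * (R\<^sup>2 + D * P\<^sup>2) - 1/2 * (P\<^sup>2 + J))
           - 1/2 * P * ((P - Q) + (R - D * P)))"
    unfolding sum_pmf_Gamma2 eqs P_def[symmetric]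
    by (simp add: A_def eqs lessThan_Suc_atMost[symmetric] field_simps)
  also have "\<dots> \<ge> A + pmf V n * (z * Q\<^sup>2 - K * (1/2 * (P\<^sup>2 + J)))"
    unfolding K_def
    by (intro add_left_mono mult_left_mono boundary_quadratic_form_ge z DJ) simp
  also have "A + pmf V n * (z * Q\<^sup>2 - K * (1/2 * (P\<^sup>2 + J))) \<ge>
      z * A + pmf V n * (z * Q\<^sup>2 - K * (1/2 * (P\<^sup>2 + J)))"
    using z A0 mult_right_mono[of z 1 A] by simp
  finally show ?thesis
    unfolding K_def[symmetric]
    by (simp add: sum_pmf_L_stopped eqs A_def Q_def algebra_simps)
qed

text \<open>
  Convergence of \<open>\<Sum> V \<Gamma>\<^sub>1(f,f)\<close> makes the error terms \<open>V(n) \<Gamma>\<^sub>1(f,f)(n)\<close> tend to zero, for each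
  fixed \<open>z\<close>.
\<close>

lemma spectral_gap_imp_integrated_BE:
  assumes gap: "spectral_gap V c"
  shows "integrated_BE V c"
  unfolding integrated_BE_def
proof (intro allI impI)
  fix f
  assume sm1: "summable (\<lambda>x. pmf V x * Gamma1 V f f x)"
    and sm2: "summable (\<lambda>x. pmf V x * Gamma2 V f f x)"
  define v1 v2 where "v1 = (\<Sum>x. pmf V x * Gamma1 V f f x)"
    and "v2 = (\<Sum>x. pmf V x * Gamma2 V f f x)"
  have Gamma1_0: "(\<lambda>n. pmf V n * Gamma1 V f f n) \<longlonglongrightarrow> 0"
    by (rule summable_LIMSEQ_zero[OF sm1])
  have energy: "(\<lambda>n. \<Sum>x<n. pmf V x * (f (Suc x) - f x)\<^sup>2) \<longlonglongrightarrow> v1"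
  proof -
    have half: "1/2 * pmf V n * (f (Suc n) - f n)\<^sup>2 \<le> pmf V n * Gamma1 V f f n" for n
    proof -
      have "pmf V n * Gamma1 V f f n = 1/2 * pmf V n * (f (Suc n) - f n)\<^sup>2
          + 1/2 * (pmf V n * death_rate V n) * (f n - f (n - 1))\<^sup>2"
        by (simp add: Gamma1_eq power2_eq_square algebra_simps)
      then show ?thesis
        by (simp add: pmf_death_rate)
    qed
    have "(\<lambda>n. 1/2 * pmf V n * (f (Suc n) - f n)\<^sup>2) \<longlonglongrightarrow> 0"
      by (rule tendsto_sandwich[OF _ _ tendsto_const Gamma1_0])
         (use half in \<open>auto intro!: always_eventually\<close>)
    with summable_LIMSEQ'[OF sm1]
    have "(\<lambda>n. (\<Sum>x\<le>n. pmf V x * Gamma1 V f f x) - 1/2 * pmf V n * (f (Suc n) - f n)\<^sup>2)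
        \<longlonglongrightarrow> v1 - 0"
      unfolding v1_def by (rule tendsto_diff)
    then show ?thesis
      by (simp add: sum_pmf_Gamma1 power2_eq_square mult.assoc)
  qed
  have bound: "z * (c * v1) \<le> v2" if z: "0 < z" "z < 1" for z
  proof (rule LIMSEQ_le)
    show "(\<lambda>n. z * (c * (\<Sum>x<n. pmf V x * (f (Suc x) - f x)\<^sup>2))
        - 9 / (8 * (1 - z)) * (pmf V n * Gamma1 V f f n)) \<longlonglongrightarrow> z * (c * v1)"
      using tendsto_diff[OF tendsto_mult_left[OF tendsto_mult_left[OF energy, of c], of z]
          tendsto_mult_left[OF Gamma1_0, of "9 / (8 * (1 - z))"]] by simp
    show "(\<lambda>n. \<Sum>x\<le>n. pmf V x * Gamma2 V f f x) \<longlonglongrightarrow> v2"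
      unfolding v2_def by (rule summable_LIMSEQ'[OF sm2])
    have "z * (c * (\<Sum>x<n. pmf V x * (f (Suc x) - f x)\<^sup>2))
        - 9 / (8 * (1 - z)) * (pmf V n * Gamma1 V f f n) \<le> (\<Sum>x\<le>n. pmf V x * Gamma2 V f f x)" for n
    proof -
      have "c * (\<Sum>x<n. pmf V x * (f (Suc x) - f x)\<^sup>2) =
          c * (\<Sum>x<n. pmf V x * (f (min (Suc x) n) - f (min x n))\<^sup>2)"
        by (intro arg_cong[where f = "(*) c"] sum.cong) auto
      also have "\<dots> \<le> (\<Sum>x\<le>n. pmf V x * (L V (\<lambda>y. f (min y n)) x)\<^sup>2)"
        using gap[unfolded spectral_gap_def, rule_format, of n "\<lambda>y. f (min y n)"] by simp
      finally have "z * (c * (\<Sum>x<n. pmf V x * (f (Suc x) - f x)\<^sup>2)) \<le>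
          z * (\<Sum>x\<le>n. pmf V x * (L V (\<lambda>y. f (min y n)) x)\<^sup>2)"
        using z by (intro mult_left_mono) auto
      then show ?thesis
        using sum_pmf_Gamma2_ge[OF z(2,1), of f n] by linarith
    qed
    then show "\<exists>K. \<forall>n\<ge>K. z * (c * (\<Sum>x<n. pmf V x * (f (Suc x) - f x)\<^sup>2))
        - 9 / (8 * (1 - z)) * (pmf V n * Gamma1 V f f n) \<le> (\<Sum>x\<le>n. pmf V x * Gamma2 V f f x)"
      by blast
  qed
  show "v2 \<ge> c * v1"
    using bound by (rule field_le_mult_one_interval)
qed

end

section \<open>The equivalence\<close>

theorem theorem1p5:
  fixes V :: "nat pmf" and c :: real
  assumes "set_pmf V = UNIV" and "c > 0"
  shows "(\<forall>f :: nat \<Rightarrow> real. summable (\<lambda>x. pmf V x * f x) \<longrightarrow>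
            Var V f \<le> ennreal (1 / c) * (\<Sum>x. ennreal (pmf V x * (f (x + 1) - f x)\<^sup>2)))
         \<longleftrightarrow> integrated_BE V c"
proof -
  have pos: "pmf V x > 0" for x
    using assms(1) by (simp add: pmf_positive)
  show ?thesis
    (is "?Poincare \<longleftrightarrow> _")
  proof
    assume ?Poincare
    then have "spectral_gap V c"
      by (intro Poincare_imp_spectral_gap pos \<open>c > 0\<close>) simp
    then show "integrated_BE V c"
      by (rule spectral_gap_imp_integrated_BE[OF pos])
  next
    assume "integrated_BE V c"
    then have "spectral_gap V c"
      by (rule integrated_BE_imp_spectral_gap[OF pos])
    then show ?Poincare
      by (intro allI impI spectral_gap_imp_Poincare pos \<open>c > 0\<close>)
  qed
qed

end
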